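(* Let $\Phi$ be a root system of type $A_n$ ($n\ge1$), with involution $\alpha\mapsto-\alpha$. Then the family $\mathcal L$ consisting of all horocyclic subsets of $\Phi$ satisfies the covector axioms of an oriented matroid, that is: (C1) $X\in\mathcal L$ implies $X\cap-X=\emptyset$; (C2) $\emptyset\in\mathcal L$; (C3) $X\in\mathcal L$ implies $-X\in\mathcal L$; (C4) $X,Y\in\mathcal L$ implies $X\circ Y\in\mathcal L$; (C5) if $X,Y\in\mathcal L$, $x\in X$ and $-x\in Y$, then there exists $Z\in\mathcal L$ such that $\{\pm x\}\cap Z=\emptyset$ and, for every $y\in\Phi$: (a) if $y\in X\cap Y$, then $y\in Z$ and $-y\notin Z$; (b) if $\{\pm y\}\cap X=\emptyset$ and $\{\pm y\}\cap Y=\{\epsilon y\}$ with $\epsilon\in\{\pm\}$, then $\epsilon y\in Z$ and $-\epsilon y\notin Z$; (c) if $\{\pm y\}\cap Y=\emptyset$ and $\{\pm y\}\cap X=\{\epsilon y\}$ with $\epsilon\in\{\pm\}$, then $\epsilon y\in Z$ and $-\epsilon y\notin Z$; (d) if $\{\pm y\}\cap X=\emptyset$ and $\{\pm y\}\cap Y=\emptyset$, then $\{\pm y\}\cap Z=\emptyset$.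
   Context: Root system of type $A_n$: $V$ is a real vector space with basis $\Delta=\{\alpha_1,\dots,\alpha_n\}$, $\Phi=\{\pm(\alpha_i+\cdots+\alpha_k):1\le i\le k\le n\}$, $\Phi^+=\{\alpha_i+\cdots+\alpha_k:1\le i\le k\le n\}$. For $1\le j\le k\le n$ put $\alpha_{j,k+1}=\alpha_j+\cdots+\alpha_k$, $\alpha_{k+1,j}=-\alpha_{j,k+1}$; $W=S_{n+1}$ acts on $\Phi$ by $w\alpha_{a,b}=\alpha_{w(a),w(b)}$. A horocyclic subset of $\Phi$ is a set of the form $w(\Phi^+\setminus\mathrm{span}_{\mathbb R}(\Delta_1))$ with $w\in W$ and $\Delta_1\subset\Delta$. For subsets $X,Y$ of $\Phi$ with $X\cap -X=\emptyset=Y\cap-Y$, the composition $X\circ Y$ is defined by: if $x\in X$, then $x\in X\circ Y$ and $-x\notin X\circ Y$; if $x\notin X$ and $-x\notin X$, then $(X\circ Y)\cap\{\pm x\}=Y\cap\{\pm x\}$. *)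

theory Defs
  imports "HOL-Analysis.Analysis" "HOL-Combinatorics.Permutations"
begin

text \<open>
  The simple roots of type \<open>A\<^sub>n\<close> are given by a family \<open>\<alpha> :: nat \<Rightarrow> 'v\<close>, of which only the
  values on \<open>{1..n}\<close> matter.
\<close>

definition is_indexed_basis :: "(nat \<Rightarrow> 'v::real_vector) \<Rightarrow> nat \<Rightarrow> bool" where
  "is_indexed_basis \<alpha> n \<longleftrightarrow>
     inj_on \<alpha> {1..n} \<and> independent (\<alpha> ` {1..n}) \<and> span (\<alpha> ` {1..n}) = UNIV"

definition simple_roots :: "(nat \<Rightarrow> 'v::real_vector) \<Rightarrow> nat \<Rightarrow> 'v set" where
  "simple_roots \<alpha> n = \<alpha> ` {1..n}"

definition pos_roots :: "(nat \<Rightarrow> 'v::real_vector) \<Rightarrow> nat \<Rightarrow> 'v set" where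
  "pos_roots \<alpha> n = {\<Sum>j=i..k. \<alpha> j | i k. 1 \<le> i \<and> i \<le> k \<and> k \<le> n}"

definition roots :: "(nat \<Rightarrow> 'v::real_vector) \<Rightarrow> nat \<Rightarrow> 'v set" where
  "roots \<alpha> n = pos_roots \<alpha> n \<union> uminus ` pos_roots \<alpha> n"

text \<open>
  \<open>root_ab \<alpha> a b\<close> is the root \<open>\<alpha>\<^bsub>a,b\<^esub>\<close>: it is \<open>\<alpha> a + \<dots> + \<alpha> (b - 1)\<close> if \<open>a < b\<close>, and
  \<open>- \<alpha>\<^bsub>b,a\<^esub>\<close> if \<open>b < a\<close>. It is a root only for distinct \<open>a, b\<close> in \<open>{1..n+1}\<close>.
\<close>

definition root_ab :: "(nat \<Rightarrow> 'v::real_vector) \<Rightarrow> nat \<Rightarrow> nat \<Rightarrow> 'v" where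
  "root_ab \<alpha> a b = (if a < b then \<Sum>j=a..<b. \<alpha> j else - (\<Sum>j=b..<a. \<alpha> j))"

text \<open>
  The action \<open>w \<alpha>\<^bsub>a,b\<^esub> = \<alpha>\<^bsub>w(a),w(b)\<^esub>\<close> of the symmetric group on the roots. The definite
  description is justified by \<open>weyl_act_root_ab\<close> below; off the roots the value is irrelevant.
\<close>

definition weyl_act :: "(nat \<Rightarrow> 'v::real_vector) \<Rightarrow> nat \<Rightarrow> (nat \<Rightarrow> nat) \<Rightarrow> 'v \<Rightarrow> 'v" where
  "weyl_act \<alpha> n w x = (THE y. \<exists>a\<in>{1..n+1}. \<exists>b\<in>{1..n+1}.
     a \<noteq> b \<and> x = root_ab \<alpha> a b \<and> y = root_ab \<alpha> (w a) (w b))"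

definition horocyclic_subsets :: "(nat \<Rightarrow> 'v::real_vector) \<Rightarrow> nat \<Rightarrow> 'v set set" where
  "horocyclic_subsets \<alpha> n =
     {weyl_act \<alpha> n w ` (pos_roots \<alpha> n - span \<Delta>\<^sub>1) | w \<Delta>\<^sub>1.
        w permutes {1..n+1} \<and> \<Delta>\<^sub>1 \<subseteq> simple_roots \<alpha> n}"

text \<open>
  The composition of sign-consistent sets \<open>X\<close> and \<open>Y\<close>; see \<open>sign_comp_iff\<close> for its
  characterisation among the subsets of \<open>\<Phi>\<close>.
\<close>

definition sign_comp :: "'v::real_vector set \<Rightarrow> 'v set \<Rightarrow> 'v set" where
  "sign_comp X Y = X \<union> {y \<in> Y. y \<notin> X \<and> - y \<notin> X}"

lemma root_ab_inj:
  fixes \<alpha> :: "nat \<Rightarrow> 'v::real_vector"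
  assumes \<alpha>: "is_indexed_basis \<alpha> n"
    and "a \<in> {1..n+1}" "b \<in> {1..n+1}" "c \<in> {1..n+1}" "d \<in> {1..n+1}" "a \<noteq> b"
    and eq: "root_ab \<alpha> a b = root_ab \<alpha> c d"
  shows "a = c \<and> b = d"
proof -
  have diff: "h b - h a = h d - h c" for h :: "nat \<Rightarrow> real"
  proof -
    define f where "f v = (let j = the_inv_into {1..n} \<alpha> v in h (Suc j) - h j)" for v
    obtain g where "linear g" and g: "\<And>v. v \<in> \<alpha> ` {1..n} \<Longrightarrow> g v = f v"
      using linear_independent_extend[of "\<alpha> ` {1..n}" f] \<alpha>
      unfolding is_indexed_basis_def by blast
    then interpret g: linear g by simp
    have g\<alpha>: "g (\<alpha> j) = h (Suc j) - h j" if "j \<in> {1..n}" for j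
      using that \<alpha> g[of "\<alpha> j"]
      by (simp add: f_def is_indexed_basis_def the_inv_into_f_f)
    have *: "g (\<Sum>j=p..<q. \<alpha> j) = h q - h p"
      if "p \<in> {1..n+1}" "q \<in> {1..n+1}" "p \<le> q" for p q
    proof -
      have "g (\<Sum>j=p..<q. \<alpha> j) = (\<Sum>j=p..<q. h (Suc j) - h j)"
        unfolding g.sum using that by (intro sum.cong) (auto simp: g\<alpha>)
      then show ?thesis using that by (simp add: sum_Suc_diff')
    qed
    have "g (root_ab \<alpha> p q) = h q - h p" if "p \<in> {1..n+1}" "q \<in> {1..n+1}" for p q
      using *[of p q] *[of q p] that by (auto simp: root_ab_def g.neg)
    from this[of a b] this[of c d] show ?thesis using assms by simp
  qed
  show ?thesis
    using diff[of "\<lambda>i. if i = a then 1 else 0"] diff[of "\<lambda>i. if i = b then 1 else 0"] \<open>a \<noteq> b\<close>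
    by (auto split: if_splits)
qed

lemma weyl_act_root_ab:
  fixes \<alpha> :: "nat \<Rightarrow> 'v::real_vector"
  assumes "is_indexed_basis \<alpha> n" "a \<in> {1..n+1}" "b \<in> {1..n+1}" "a \<noteq> b"
  shows "weyl_act \<alpha> n w (root_ab \<alpha> a b) = root_ab \<alpha> (w a) (w b)"
  unfolding weyl_act_def
proof (rule the_equality)
  show "\<exists>a'\<in>{1..n+1}. \<exists>b'\<in>{1..n+1}. a' \<noteq> b' \<and> root_ab \<alpha> a b = root_ab \<alpha> a' b' \<and>
          root_ab \<alpha> (w a) (w b) = root_ab \<alpha> (w a') (w b')"
    using assms by blast
next
  fix y
  assume "\<exists>a'\<in>{1..n+1}. \<exists>b'\<in>{1..n+1}. a' \<noteq> b' \<and> root_ab \<alpha> a b = root_ab \<alpha> a' b' \<and>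
            y = root_ab \<alpha> (w a') (w b')"
  then show "y = root_ab \<alpha> (w a) (w b)"
    using root_ab_inj[OF assms(1)] assms(2-4) by metis
qed

lemma roots_eq_root_ab:
  "roots \<alpha> n = {root_ab \<alpha> a b | a b. a \<in> {1..n+1} \<and> b \<in> {1..n+1} \<and> a \<noteq> b}"
proof -
  have pos: "pos_roots \<alpha> n = {root_ab \<alpha> a b | a b. 1 \<le> a \<and> a < b \<and> b \<le> n+1}"
  proof (intro set_eqI iffI)
    fix x assume "x \<in> pos_roots \<alpha> n"
    then obtain i k where "x = (\<Sum>j=i..k. \<alpha> j)" "1 \<le> i" "i \<le> k" "k \<le> n"
      unfolding pos_roots_def by blast
    then have "x = root_ab \<alpha> i (Suc k)" "1 \<le> i" "i < Suc k" "Suc k \<le> n+1"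
      by (auto simp: root_ab_def atLeastLessThanSuc_atLeastAtMost)
    then show "x \<in> {root_ab \<alpha> a b | a b. 1 \<le> a \<and> a < b \<and> b \<le> n+1}" by blast
  next
    fix x assume "x \<in> {root_ab \<alpha> a b | a b. 1 \<le> a \<and> a < b \<and> b \<le> n+1}"
    then obtain a b where x: "x = root_ab \<alpha> a b" "1 \<le> a" "a < b" "b \<le> n+1" by blast
    then obtain k where "b = Suc k" by (cases b) auto
    with x have "x = (\<Sum>j=a..k. \<alpha> j)" "1 \<le> a" "a \<le> k" "k \<le> n"
      by (auto simp: root_ab_def atLeastLessThanSuc_atLeastAtMost)
    then show "x \<in> pos_roots \<alpha> n" unfolding pos_roots_def by blast
  qed
  have neg: "- root_ab \<alpha> a b = root_ab \<alpha> b a" for a b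
    by (auto simp: root_ab_def)
  show ?thesis
  proof (intro set_eqI iffI)
    fix x assume "x \<in> roots \<alpha> n"
    then obtain a b where "1 \<le> a" "a < b" "b \<le> n+1" "x = root_ab \<alpha> a b \<or> x = root_ab \<alpha> b a"
      unfolding roots_def pos by (auto simp: neg)
    moreover from this have "a \<in> {1..n+1}" "b \<in> {1..n+1}" "a \<noteq> b" "b \<noteq> a" by auto
    ultimately show "x \<in> {root_ab \<alpha> a b | a b. a \<in> {1..n+1} \<and> b \<in> {1..n+1} \<and> a \<noteq> b}" by blast
  next
    fix x assume "x \<in> {root_ab \<alpha> a b | a b. a \<in> {1..n+1} \<and> b \<in> {1..n+1} \<and> a \<noteq> b}"
    then obtain a b where x: "x = root_ab \<alpha> a b" "a \<in> {1..n+1}" "b \<in> {1..n+1}" "a \<noteq> b" by blast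
    show "x \<in> roots \<alpha> n"
    proof (cases "a < b")
      case True
      with x have "x \<in> pos_roots \<alpha> n" unfolding pos by auto
      then show ?thesis by (simp add: roots_def)
    next
      case False
      with x have "1 \<le> b" "b < a" "a \<le> n+1" by auto
      then have "root_ab \<alpha> b a \<in> pos_roots \<alpha> n" unfolding pos by blast
      moreover have "x = - root_ab \<alpha> b a" by (simp only: x neg)
      ultimately show ?thesis by (simp add: roots_def)
    qed
  qed
qed

lemma sign_comp_iff:
  fixes \<Phi> X Y Z :: "'v::real_vector set"
  assumes "uminus ` \<Phi> = \<Phi>" "X \<subseteq> \<Phi>" "Y \<subseteq> \<Phi>" "Z \<subseteq> \<Phi>" "X \<inter> uminus ` X = {}" "Y \<inter> uminus ` Y = {}"
  shows "Z = sign_comp X Y \<longleftrightarrow>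
    (\<forall>x\<in>\<Phi>. (x \<in> X \<longrightarrow> x \<in> Z \<and> - x \<notin> Z) \<and>
            (x \<notin> X \<and> - x \<notin> X \<longrightarrow> Z \<inter> {x, - x} = Y \<inter> {x, - x}))"
    (is "_ \<longleftrightarrow> ?R")
proof
  have X: "- x \<notin> X" if "x \<in> X" for x
    using assms(5) that by (metis disjoint_iff image_eqI minus_minus)
  {
    assume "Z = sign_comp X Y"
    then show ?R using X by (auto simp: sign_comp_def)
  next
    assume R: ?R
    have "x \<in> Z \<longleftrightarrow> x \<in> sign_comp X Y" if "x \<in> \<Phi>" for x
    proof -
      have "- x \<in> \<Phi>" using assms(1) that by blast
      then consider "x \<in> X" | "- x \<in> X" "x \<notin> X" | "x \<notin> X" "- x \<notin> X" by blast
      then show ?thesis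
      proof cases
        case 1 then show ?thesis using R that by (simp add: sign_comp_def)
      next
        case 2 then show ?thesis
          using R \<open>- x \<in> \<Phi>\<close> by (auto simp: sign_comp_def dest: bspec[of _ _ "- x"])
      next
        case 3 then show ?thesis using R that by (auto simp: sign_comp_def)
      qed
    qed
    moreover have "sign_comp X Y \<subseteq> \<Phi>" using assms by (auto simp: sign_comp_def)
    ultimately show "Z = sign_comp X Y" using assms(4) by blast
  }
qed

end

theory Submission
  imports Defs
begin

text \<open>
  The horocyclic subsets of \<open>A\<^sub>n\<close> are exactly the sets
  \<open>{\<alpha>\<^bsub>a,b\<^esub> | f a < f b}\<close> for real functions \<open>f\<close> on \<open>{1..n+1}\<close>: the permutation \<open>w\<close> sorts
  \<open>f\<close>, and \<open>\<Delta>\<^sub>1\<close> records where the sorted \<open>f\<close> does not increase. Hence they are the covectors of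
  the braid arrangement, and as there, the axioms are witnessed by \<open>0\<close>, \<open>- f\<close>, \<open>f + e g\<close> with small
  \<open>e > 0\<close>, and, for elimination, the positive combination of \<open>f\<close> and \<open>g\<close> that vanishes on the
  given root.
\<close>

definition level_roots :: "(nat \<Rightarrow> 'v::real_vector) \<Rightarrow> nat \<Rightarrow> (nat \<Rightarrow> real) \<Rightarrow> 'v set" where
  "level_roots \<alpha> n f =
     {root_ab \<alpha> a b | a b. a \<in> {1..n+1} \<and> b \<in> {1..n+1} \<and> f a < f b}"

section \<open>Roots in terms of pairs of indices\<close>

lemma uminus_root_ab: "- root_ab \<alpha> a b = root_ab \<alpha> b a"
  by (auto simp: root_ab_def)

text \<open>A root determines its pair of indices, so no other pair can witness membership. This
  turns all later questions about membership of roots into comparisons of real numbers.\<close>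

lemma root_ab_in_level_roots_iff:
  assumes "is_indexed_basis \<alpha> n" "a \<in> {1..n+1}" "b \<in> {1..n+1}" "a \<noteq> b"
  shows "root_ab \<alpha> a b \<in> level_roots \<alpha> n f \<longleftrightarrow> f a < f b"
proof
  assume "root_ab \<alpha> a b \<in> level_roots \<alpha> n f"
  then obtain c d where "root_ab \<alpha> a b = root_ab \<alpha> c d" "c \<in> {1..n+1}" "d \<in> {1..n+1}" "f c < f d"
    unfolding level_roots_def by blast
  then show "f a < f b" using root_ab_inj[OF assms(1-3) _ _ assms(4)] by metis
next
  assume "f a < f b"
  then show "root_ab \<alpha> a b \<in> level_roots \<alpha> n f"
    using assms unfolding level_roots_def by blast
qed

lemma pos_roots_eq_root_ab:
  "pos_roots \<alpha> n = {root_ab \<alpha> a b | a b. a \<in> {1..n+1} \<and> b \<in> {1..n+1} \<and> a < b}"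
proof (intro set_eqI iffI)
  fix x assume "x \<in> pos_roots \<alpha> n"
  then obtain i k where "x = (\<Sum>j=i..k. \<alpha> j)" "1 \<le> i" "i \<le> k" "k \<le> n"
    unfolding pos_roots_def by blast
  then have "x = root_ab \<alpha> i (Suc k)" "i \<in> {1..n+1}" "Suc k \<in> {1..n+1}" "i < Suc k"
    by (auto simp: root_ab_def atLeastLessThanSuc_atLeastAtMost)
  then show "x \<in> {root_ab \<alpha> a b | a b. a \<in> {1..n+1} \<and> b \<in> {1..n+1} \<and> a < b}" by blast
next
  fix x assume "x \<in> {root_ab \<alpha> a b | a b. a \<in> {1..n+1} \<and> b \<in> {1..n+1} \<and> a < b}"
  then obtain a b where x: "x = root_ab \<alpha> a b" "a \<in> {1..n+1}" "b \<in> {1..n+1}" "a < b" by blast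
  then obtain k where "b = Suc k" by (cases b) auto
  with x have "x = (\<Sum>j=a..k. \<alpha> j)" "1 \<le> a" "a \<le> k" "k \<le> n"
    by (auto simp: root_ab_def atLeastLessThanSuc_atLeastAtMost)
  then show "x \<in> pos_roots \<alpha> n" unfolding pos_roots_def by blast
qed

section \<open>Positive roots outside the span of some simple roots\<close>

text \<open>If some \<open>j\<close> in \<open>K\<close> were missing from \<open>J\<close>, then
  both the full sum and the sum over \<open>K - {j}\<close> would lie in the span of the vectors
  other than \<open>\<alpha> j\<close>. Their difference \<open>\<alpha> j\<close> would too,
  against independence.\<close>

lemma sum_in_span_image_iff:
  fixes \<alpha> :: "nat \<Rightarrow> 'v::real_vector"
  assumes inj: "inj_on \<alpha> I" and indep: "independent (\<alpha> ` I)"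
    and K: "K \<subseteq> I" "finite K" and J: "J \<subseteq> I"
  shows "(\<Sum>j\<in>K. \<alpha> j) \<in> span (\<alpha> ` J) \<longleftrightarrow> K \<subseteq> J"
proof
  assume "K \<subseteq> J"
  then show "(\<Sum>j\<in>K. \<alpha> j) \<in> span (\<alpha> ` J)" by (intro span_sum span_base) blast
next
  assume sum: "(\<Sum>j\<in>K. \<alpha> j) \<in> span (\<alpha> ` J)"
  show "K \<subseteq> J"
  proof (rule ccontr)
    assume "\<not> K \<subseteq> J"
    then obtain j where j: "j \<in> K" "j \<notin> J" by blast
    let ?B = "\<alpha> ` I - {\<alpha> j}"
    have in_B: "\<alpha> i \<in> ?B" if "i \<in> I" "i \<noteq> j" for i
      using that inj j K(1) by (auto dest: inj_onD)
    have "\<alpha> ` J \<subseteq> ?B"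
    proof (rule image_subsetI)
      fix i assume "i \<in> J"
      then show "\<alpha> i \<in> ?B" using J j by (intro in_B) auto
    qed
    from span_mono[OF this] sum have "(\<Sum>i\<in>K. \<alpha> i) \<in> span ?B" by (rule subsetD)
    moreover have "(\<Sum>i\<in>K - {j}. \<alpha> i) \<in> span ?B"
      using K(1) by (intro span_sum span_base in_B) auto
    ultimately have "(\<Sum>i\<in>K. \<alpha> i) - (\<Sum>i\<in>K - {j}. \<alpha> i) \<in> span ?B" by (rule span_diff)
    then have "\<alpha> j \<in> span ?B" using j K by (simp add: sum_diff1)
    moreover have "\<alpha> j \<in> \<alpha> ` I" using j K(1) by (intro imageI) (rule subsetD)
    ultimately show False using indep unfolding dependent_def by (meson bexI)
  qed
qed

text \<open>A function without a strict step between \<open>a\<close> and \<open>b\<close> cannot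
  rise there, and by monotonicity a strict step is never undone. The steps \<open>j\<close> in
  \<open>{a..<b}\<close> are the indices of the simple roots that sum to
  \<open>root_ab \<alpha> a b\<close>.\<close>

lemma mono_less_iff_step:
  fixes h :: "nat \<Rightarrow> 'a::linorder"
  assumes "mono_on {p..q} h" "p \<le> a" "a \<le> b" "b \<le> q"
  shows "h a < h b \<longleftrightarrow> (\<exists>j\<in>{a..<b}. h j < h (Suc j))"
proof
  assume "h a < h b"
  show "\<exists>j\<in>{a..<b}. h j < h (Suc j)"
  proof (rule ccontr)
    assume contr: "\<not> ?thesis"
    have "h b \<le> h a" using \<open>a \<le> b\<close> contr
    proof (induction b rule: dec_induct)
      case (step m)
      then have "h m \<le> h a" by auto
      moreover have "h (Suc m) \<le> h m" using step by (auto simp: not_less)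
      ultimately show ?case by simp
    qed simp
    with \<open>h a < h b\<close> show False by simp
  qed
next
  assume "\<exists>j\<in>{a..<b}. h j < h (Suc j)"
  then obtain j where j: "a \<le> j" "j < b" "h j < h (Suc j)" by auto
  have "h a \<le> h j" using j assms by (intro mono_onD[OF assms(1)]) auto
  moreover have "h (Suc j) \<le> h b" using j assms by (intro mono_onD[OF assms(1)]) auto
  ultimately show "h a < h b" using j by simp
qed

text \<open>For \<open>a < b\<close>, the root \<open>root_ab \<alpha> a b\<close> leaves the span
  exactly when one of its simple summands has an index outside \<open>J\<close>, that is, when
  \<open>h\<close> has a strict step between \<open>a\<close> and \<open>b\<close>.\<close>

lemma pos_roots_minus_span:
  fixes \<alpha> :: "nat \<Rightarrow> 'v::real_vector"
  assumes \<alpha>: "is_indexed_basis \<alpha> n" and h: "mono_on {1..n+1} h"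
    and J: "J \<subseteq> {1..n}" "\<And>j. j \<in> {1..n} \<Longrightarrow> j \<in> J \<longleftrightarrow> h j = h (Suc j)"
  shows "pos_roots \<alpha> n - span (\<alpha> ` J) = level_roots \<alpha> n h"
proof -
  \<comment> \<open>Monotonicity of \<open>h\<close> makes every root in
    \<open>level_roots \<alpha> n h\<close> positive.\<close>
  have less: "a < b" if "a \<in> {1..n+1}" "b \<in> {1..n+1}" "h a < h b" for a b
    using that mono_onD[OF h, of b a] by (meson leD leI)
  have key: "root_ab \<alpha> a b \<notin> span (\<alpha> ` J) \<longleftrightarrow> h a < h b"
    if ab: "a \<in> {1..n+1}" "b \<in> {1..n+1}" "a < b" for a b
  proof -
    have step: "j \<notin> J \<longleftrightarrow> h j < h (Suc j)" if "j \<in> {a..<b}" for j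
      using that ab J(2)[of j] mono_onD[OF h, of j "Suc j"] by force
    have "root_ab \<alpha> a b \<in> span (\<alpha> ` J) \<longleftrightarrow> {a..<b} \<subseteq> J"
      using \<alpha> J(1) ab by (simp add: root_ab_def is_indexed_basis_def,
        intro sum_in_span_image_iff[where I="{1..n}"]) auto
    also have "\<dots> \<longleftrightarrow> \<not> (\<exists>j\<in>{a..<b}. h j < h (Suc j))" using step by blast
    also have "\<dots> \<longleftrightarrow> \<not> h a < h b" using mono_less_iff_step[OF h, of a b] ab by simp
    finally show ?thesis by blast
  qed
  show ?thesis
    unfolding pos_roots_eq_root_ab level_roots_def using less key by blast
qed

section \<open>The action of the symmetric group, and sorting\<close>

text \<open>Comparing \<open>a\<close> and \<open>b\<close> by \<open>f \<circ> w\<close> is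
  comparing \<open>w a\<close> and \<open>w b\<close> by \<open>f\<close>, and \<open>w\<close>
  moves the indices of a root in just this way. Surjectivity of \<open>w\<close> on the index set
  gives the inclusion from right to left.\<close>

lemma weyl_act_level_roots:
  fixes \<alpha> :: "nat \<Rightarrow> 'v::real_vector"
  assumes \<alpha>: "is_indexed_basis \<alpha> n" and w: "w permutes {1..n+1}"
  shows "weyl_act \<alpha> n w ` level_roots \<alpha> n (f \<circ> w) = level_roots \<alpha> n f"
proof (intro set_eqI iffI)
  fix x assume "x \<in> weyl_act \<alpha> n w ` level_roots \<alpha> n (f \<circ> w)"
  then obtain a b where ab: "a \<in> {1..n+1}" "b \<in> {1..n+1}" "f (w a) < f (w b)"
    and x: "x = weyl_act \<alpha> n w (root_ab \<alpha> a b)"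
    unfolding level_roots_def by auto
  have "a \<noteq> b" using ab by auto
  then have "x = root_ab \<alpha> (w a) (w b)" using x weyl_act_root_ab[OF \<alpha>] ab by blast
  moreover have "w a \<in> {1..n+1}" "w b \<in> {1..n+1}" using permutes_in_image[OF w] ab by blast+
  ultimately show "x \<in> level_roots \<alpha> n f" using ab unfolding level_roots_def by blast
next
  fix x assume "x \<in> level_roots \<alpha> n f"
  then obtain c d where cd: "c \<in> w ` {1..n+1}" "d \<in> w ` {1..n+1}" "f c < f d"
    and x: "x = root_ab \<alpha> c d"
    unfolding level_roots_def permutes_image[OF w] by blast
  then obtain a b where ab: "a \<in> {1..n+1}" "b \<in> {1..n+1}" "c = w a" "d = w b" by blast
  then have "a \<noteq> b" using cd by auto
  then have "x = weyl_act \<alpha> n w (root_ab \<alpha> a b)" using x weyl_act_root_ab[OF \<alpha>] ab by metis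
  moreover have "root_ab \<alpha> a b \<in> level_roots \<alpha> n (f \<circ> w)"
    unfolding level_roots_def using ab cd by auto
  ultimately show "x \<in> weyl_act \<alpha> n w ` level_roots \<alpha> n (f \<circ> w)" by blast
qed

text \<open>The permutation lists the indices in the order obtained by sorting them by their
  \<open>f\<close>-values.\<close>

lemma ex_sorting_permutation:
  fixes f :: "nat \<Rightarrow> 'a::linorder"
  obtains w where "w permutes {1..m}" "mono_on {1..m} (f \<circ> w)"
proof -
  define xs where "xs = sort_key f [1..<Suc m]"
  have xs: "length xs = m" "distinct xs" "set xs = {1..m}" "sorted (map f xs)"
    by (auto simp: xs_def simp flip: atLeastLessThanSuc_atLeastAtMost)
  \<comment> \<open>List positions start at 0 and indices at 1, hence the shift;
    \<open>permutes\<close> requires the identity outside \<open>{1..m}\<close>.\<close>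
  define w where "w i = (if i \<in> {1..m} then xs ! (i - 1) else i)" for i
  have "bij_betw (\<lambda>i. i - 1) {1..m} {..<length xs}"
    by (rule bij_betw_byWitness[where f'=Suc]) (auto simp: xs)
  moreover have "bij_betw ((!) xs) {..<length xs} {1..m}"
    using bij_betw_nth[OF xs(2) refl xs(3)[symmetric]] .
  ultimately have "bij_betw (\<lambda>i. xs ! (i - 1)) {1..m} {1..m}"
    using bij_betw_trans by (fastforce simp: comp_def)
  then have "bij_betw w {1..m} {1..m}"
    by (subst bij_betw_cong[where g="\<lambda>i. xs ! (i - 1)"]) (auto simp: w_def)
  then have "w permutes {1..m}" by (rule bij_imp_permutes) (auto simp: w_def)
  moreover have "mono_on {1..m} (f \<circ> w)"
  proof (rule mono_onI)
    fix i j assume "i \<in> {1..m}" "j \<in> {1..m}" "i \<le> j"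
    then show "(f \<circ> w) i \<le> (f \<circ> w) j"
      using sorted_nth_mono[OF xs(4), of "i - 1" "j - 1"] xs(1) by (simp add: w_def)
  qed
  ultimately show ?thesis using that by blast
qed

lemma horocyclic_subsets_eq_level_roots:
  fixes \<alpha> :: "nat \<Rightarrow> 'v::real_vector"
  assumes \<alpha>: "is_indexed_basis \<alpha> n"
  shows "horocyclic_subsets \<alpha> n = range (level_roots \<alpha> n)"
proof (intro set_eqI iffI)
  fix X assume "X \<in> horocyclic_subsets \<alpha> n"
  then obtain w \<Delta> where w: "w permutes {1..n+1}" and \<Delta>: "\<Delta> \<subseteq> \<alpha> ` {1..n}"
    and X: "X = weyl_act \<alpha> n w ` (pos_roots \<alpha> n - span \<Delta>)"
    unfolding horocyclic_subsets_def simple_roots_def by blast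
  obtain J where J: "J \<subseteq> {1..n}" "\<Delta> = \<alpha> ` J" using \<Delta> by (meson subset_imageE)
  \<comment> \<open>Counting the indices below \<open>i\<close> that lie outside \<open>J\<close>
    gives a monotone function that is constant from \<open>j\<close> to \<open>Suc j\<close> exactly
    for \<open>j\<close> in \<open>J\<close>.\<close>
  define h where "h i = real (card ({1..<i} - J))" for i
  have h_Suc: "h (Suc j) = h j + (if j \<in> J then 0 else 1)" if "j \<in> {1..n}" for j
    using that by (auto simp: h_def atLeastLessThanSuc insert_Diff_if)
  have "mono_on {1..n+1} h"
    by (intro mono_onI) (auto simp: h_def intro!: card_mono)
  then have "pos_roots \<alpha> n - span \<Delta> = level_roots \<alpha> n h"
    unfolding J(2) by (intro pos_roots_minus_span[OF \<alpha>] J(1)) (auto simp: h_Suc)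
  \<comment> \<open>In this form the action of \<open>w\<close> yields the level set of
    \<open>h \<circ> inv w\<close>.\<close>
  also have "h = (h \<circ> inv w) \<circ> w" using permutes_inv_o(2)[OF w] by (simp add: comp_assoc)
  finally show "X \<in> range (level_roots \<alpha> n)"
    unfolding X using weyl_act_level_roots[OF \<alpha> w] by (metis rangeI)
next
  fix X assume "X \<in> range (level_roots \<alpha> n)"
  then obtain f where X: "X = level_roots \<alpha> n f" by blast
  obtain w where w: "w permutes {1..n+1}" "mono_on {1..n+1} (f \<circ> w)"
    by (rule ex_sorting_permutation)
  define J where "J = {j \<in> {1..n}. f (w j) = f (w (Suc j))}"
  have J: "J \<subseteq> {1..n}" by (auto simp: J_def)
  have "pos_roots \<alpha> n - span (\<alpha> ` J) = level_roots \<alpha> n (f \<circ> w)"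
    by (intro pos_roots_minus_span[OF \<alpha> w(2) J]) (auto simp: J_def)
  then have "X = weyl_act \<alpha> n w ` (pos_roots \<alpha> n - span (\<alpha> ` J))"
    using weyl_act_level_roots[OF \<alpha> w(1)] X by metis
  moreover have "\<alpha> ` J \<subseteq> simple_roots \<alpha> n" using J by (auto simp: simple_roots_def)
  ultimately show "X \<in> horocyclic_subsets \<alpha> n"
    unfolding horocyclic_subsets_def using w(1) by blast
qed

section \<open>The covector axioms\<close>

text \<open>By continuity each strict inequality between values of \<open>f\<close> survives adding
  \<open>e * g\<close> for small \<open>e > 0\<close>. Finitely many pairs allow a common
  \<open>e\<close>, and where \<open>f\<close> ties, positivity of \<open>e\<close> leaves the
  decision to \<open>g\<close>.\<close>

lemma ex_lexicographic_perturbation: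
  fixes f g :: "'a \<Rightarrow> real"
  assumes "finite S"
  obtains e where "\<And>a b. a \<in> S \<Longrightarrow> b \<in> S \<Longrightarrow>
    f a + e * g a < f b + e * g b \<longleftrightarrow> f a < f b \<or> f a = f b \<and> g a < g b"
proof -
  have "\<forall>\<^sub>F e in at_right 0. f a < f b \<longrightarrow> f a + e * g a < f b + e * g b" for a b
  proof (cases "f a < f b")
    case True
    have "((\<lambda>e. f b + e * g b - (f a + e * g a)) \<longlongrightarrow> f b + 0 * g b - (f a + 0 * g a)) (at_right 0)"
      by (intro tendsto_intros)
    then have "\<forall>\<^sub>F e in at_right 0. 0 < f b + e * g b - (f a + e * g a)"
      using True by (intro order_tendstoD(1)) auto
    then show ?thesis by (rule eventually_mono) simp
  qed simp
  then have "\<forall>\<^sub>F e in at_right 0. \<forall>a\<in>S. \<forall>b\<in>S. f a < f b \<longrightarrow> f a + e * g a < f b + e * g b"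
    using assms by (intro eventually_ball_finite ballI) auto
  then have "\<forall>\<^sub>F e in at_right (0::real). 0 < e \<and>
      (\<forall>a\<in>S. \<forall>b\<in>S. f a < f b \<longrightarrow> f a + e * g a < f b + e * g b)"
    using eventually_at_right_less by (rule eventually_conj[rotated])
  then obtain e :: real where "0 < e"
    and e: "\<forall>a\<in>S. \<forall>b\<in>S. f a < f b \<longrightarrow> f a + e * g a < f b + e * g b"
    using eventually_happens'[OF trivial_limit_at_right_real] by blast
  have "f a + e * g a < f b + e * g b \<longleftrightarrow> f a < f b \<or> f a = f b \<and> g a < g b"
    if "a \<in> S" "b \<in> S" for a b
    \<comment> \<open>For \<open>f b < f a\<close> the property of \<open>e\<close> with
      \<open>a\<close> and \<open>b\<close> exchanged refutes the left-hand side.\<close>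
    using e that \<open>0 < e\<close> by (cases "f a" "f b" rule: linorder_cases) (auto dest: less_asym)
  then show ?thesis using that by blast
qed

theorem theorem7p4:
  fixes \<alpha> :: "nat \<Rightarrow> 'v::real_vector" and n :: nat
  assumes "n \<ge> 1"
    and "is_indexed_basis \<alpha> n"
  shows
    "(\<forall>X\<in>horocyclic_subsets \<alpha> n. X \<inter> uminus ` X = {}) \<and>
     {} \<in> horocyclic_subsets \<alpha> n \<and>
     (\<forall>X\<in>horocyclic_subsets \<alpha> n. uminus ` X \<in> horocyclic_subsets \<alpha> n) \<and>
     (\<forall>X\<in>horocyclic_subsets \<alpha> n. \<forall>Y\<in>horocyclic_subsets \<alpha> n.
        sign_comp X Y \<in> horocyclic_subsets \<alpha> n) \<and>
     (\<forall>X\<in>horocyclic_subsets \<alpha> n. \<forall>Y\<in>horocyclic_subsets \<alpha> n. \<forall>x. x \<in> X \<and> - x \<in> Y \<longrightarrow>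
        (\<exists>Z\<in>horocyclic_subsets \<alpha> n. {x, - x} \<inter> Z = {} \<and>
          (\<forall>y\<in>roots \<alpha> n.
             (y \<in> X \<inter> Y \<longrightarrow> y \<in> Z \<and> - y \<notin> Z) \<and>
             (\<forall>\<epsilon>\<in>{1, - 1 :: real}.
                {y, - y} \<inter> X = {} \<and> {y, - y} \<inter> Y = {\<epsilon> *\<^sub>R y} \<longrightarrow>
                  \<epsilon> *\<^sub>R y \<in> Z \<and> - (\<epsilon> *\<^sub>R y) \<notin> Z) \<and>
             (\<forall>\<epsilon>\<in>{1, - 1 :: real}.
                {y, - y} \<inter> Y = {} \<and> {y, - y} \<inter> X = {\<epsilon> *\<^sub>R y} \<longrightarrow>
                  \<epsilon> *\<^sub>R y \<in> Z \<and> - (\<epsilon> *\<^sub>R y) \<notin> Z) \<and>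
             ({y, - y} \<inter> X = {} \<and> {y, - y} \<inter> Y = {} \<longrightarrow> {y, - y} \<inter> Z = {}))))"
proof -
  note \<alpha> = assms(2)
  note iff = root_ab_in_level_roots_iff[OF \<alpha>]
  let ?L = "level_roots \<alpha> n"
  have level_rootsE: "\<exists>a b. x = root_ab \<alpha> a b \<and> a \<in> {1..n+1} \<and> b \<in> {1..n+1} \<and> a \<noteq> b \<and> f a < f b"
    if "x \<in> ?L f" for x f using that unfolding level_roots_def by fastforce
  have C1: "- x \<notin> ?L f" if "x \<in> ?L f" for x f
    using level_rootsE[OF that] by (auto simp: uminus_root_ab iff)
  have C2: "?L (\<lambda>_. 0) = {}" by (simp add: level_roots_def)
  have C3: "uminus ` ?L f = ?L (\<lambda>i. - f i)" for f
    by (force simp: level_roots_def uminus_root_ab image_iff)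
  \<comment> \<open>A root and its negative both avoid \<open>?L f\<close> exactly when
    \<open>f\<close> ties on its indices. So composition compares by \<open>f\<close> first and
    breaks ties by \<open>g\<close>, which is the lexicographic comparison.\<close>
  have C4: "\<exists>h. sign_comp (?L f) (?L g) = ?L h" for f g
  proof -
    obtain e where e: "\<And>a b. a \<in> {1..n+1} \<Longrightarrow> b \<in> {1..n+1} \<Longrightarrow>
        f a + e * g a < f b + e * g b \<longleftrightarrow> f a < f b \<or> f a = f b \<and> g a < g b"
      using ex_lexicographic_perturbation[of "{1..n+1}" f g] by auto
    let ?h = "\<lambda>i. f i + e * g i"
    have "x \<in> sign_comp (?L f) (?L g) \<longleftrightarrow> x \<in> ?L ?h" if x: "x \<in> roots \<alpha> n" for x
    proof -
      obtain a b where ab: "x = root_ab \<alpha> a b" "a \<in> {1..n+1}" "b \<in> {1..n+1}" "a \<noteq> b"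
        using x unfolding roots_eq_root_ab by blast
      have "x \<in> ?L ?h \<longleftrightarrow> f a < f b \<or> f a = f b \<and> g a < g b"
        using e iff[of a b ?h] ab by simp
      then show ?thesis
        using ab by (auto simp: sign_comp_def uminus_root_ab iff)
    qed
    moreover have sub: "?L k \<subseteq> roots \<alpha> n" for k
      using level_rootsE unfolding roots_eq_root_ab by blast
    moreover have "sign_comp (?L f) (?L g) \<subseteq> roots \<alpha> n"
      using sub by (auto simp: sign_comp_def)
    ultimately show ?thesis by blast
  qed
  \<comment> \<open>Elimination is first proved without signs: the exclusions of negatives follow
    from \<open>C1\<close>, and the case \<open>\<epsilon> = - 1\<close> is the unsigned claim for
    \<open>- y\<close>.\<close>
  have C5: "\<exists>h. x \<notin> ?L h \<and> - x \<notin> ?L h \<and> (\<forall>y\<in>roots \<alpha> n.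
      (y \<in> ?L f \<and> y \<in> ?L g \<longrightarrow> y \<in> ?L h) \<and>
      (y \<notin> ?L f \<and> - y \<notin> ?L f \<and> y \<in> ?L g \<longrightarrow> y \<in> ?L h) \<and>
      (y \<notin> ?L g \<and> - y \<notin> ?L g \<and> y \<in> ?L f \<longrightarrow> y \<in> ?L h) \<and>
      (y \<notin> ?L f \<and> - y \<notin> ?L f \<and> y \<notin> ?L g \<and> - y \<notin> ?L g \<longrightarrow> y \<notin> ?L h))"
    if "x \<in> ?L f" "- x \<in> ?L g" for x f g
  proof -
    obtain a b where ab: "x = root_ab \<alpha> a b" "a \<in> {1..n+1}" "b \<in> {1..n+1}" "a \<noteq> b" "f a < f b"
      using level_rootsE[OF \<open>x \<in> ?L f\<close>] by blast
    then have "g b < g a" using that by (auto simp: uminus_root_ab iff)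
    \<comment> \<open>These positive weights balance the rise of \<open>f\<close> from
      \<open>a\<close> to \<open>b\<close> against the fall of \<open>g\<close>:
      \<open>s * (f b - f a) = t * (g a - g b)\<close>, so \<open>?h\<close> ties at
      \<open>a\<close> and \<open>b\<close>.\<close>
    define s t where "s = g a - g b" and "t = f b - f a"
    have st: "0 < s" "0 < t" using ab \<open>g b < g a\<close> by (auto simp: s_def t_def)
    let ?h = "\<lambda>i. s * f i + t * g i"
    have "?h a = ?h b" by (simp add: s_def t_def algebra_simps)
    then have "x \<notin> ?L ?h" "- x \<notin> ?L ?h" using ab by (auto simp: uminus_root_ab iff)
    moreover have "(y \<in> ?L f \<and> y \<in> ?L g \<longrightarrow> y \<in> ?L ?h) \<and>
        (y \<notin> ?L f \<and> - y \<notin> ?L f \<and> y \<in> ?L g \<longrightarrow> y \<in> ?L ?h) \<and>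
        (y \<notin> ?L g \<and> - y \<notin> ?L g \<and> y \<in> ?L f \<longrightarrow> y \<in> ?L ?h) \<and>
        (y \<notin> ?L f \<and> - y \<notin> ?L f \<and> y \<notin> ?L g \<and> - y \<notin> ?L g \<longrightarrow> y \<notin> ?L ?h)"
      if y: "y \<in> roots \<alpha> n" for y
    proof -
      obtain c d where cd: "y = root_ab \<alpha> c d" "c \<in> {1..n+1}" "d \<in> {1..n+1}" "c \<noteq> d"
        using y unfolding roots_eq_root_ab by blast
      \<comment> \<open>Clauses (a) to (c) all fall under this: neither function decreases and at
        least one increases. Clause (d) is a tie of both.\<close>
      have "?h c < ?h d" if "f c \<le> f d" "g c \<le> g d" "f c < f d \<or> g c < g d"
        using that st by (auto intro: add_le_less_mono add_less_le_mono)
      moreover have "?h c = ?h d" if "f c = f d" "g c = g d" using that by simp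
      ultimately show ?thesis using cd by (auto simp: uminus_root_ab iff)
    qed
    ultimately show ?thesis by blast
  qed
  have uminus_roots: "- y \<in> roots \<alpha> n" if "y \<in> roots \<alpha> n" for y
    using that by (auto simp: roots_def)
  have elim: "\<exists>Z\<in>range ?L. {x, - x} \<inter> Z = {} \<and>
      (\<forall>y\<in>roots \<alpha> n.
         (y \<in> X \<inter> Y \<longrightarrow> y \<in> Z \<and> - y \<notin> Z) \<and>
         (\<forall>\<epsilon>\<in>{1, - 1 :: real}.
            {y, - y} \<inter> X = {} \<and> {y, - y} \<inter> Y = {\<epsilon> *\<^sub>R y} \<longrightarrow>
              \<epsilon> *\<^sub>R y \<in> Z \<and> - (\<epsilon> *\<^sub>R y) \<notin> Z) \<and>
         (\<forall>\<epsilon>\<in>{1, - 1 :: real}.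
            {y, - y} \<inter> Y = {} \<and> {y, - y} \<inter> X = {\<epsilon> *\<^sub>R y} \<longrightarrow>
              \<epsilon> *\<^sub>R y \<in> Z \<and> - (\<epsilon> *\<^sub>R y) \<notin> Z) \<and>
         ({y, - y} \<inter> X = {} \<and> {y, - y} \<inter> Y = {} \<longrightarrow> {y, - y} \<inter> Z = {}))"
    if X: "X \<in> range ?L" and Y: "Y \<in> range ?L" and x: "x \<in> X \<and> - x \<in> Y" for X Y x
  proof -
    obtain f g where fg: "X = ?L f" "Y = ?L g" using X Y by blast
    from x have "x \<in> ?L f" "- x \<in> ?L g" by (simp_all add: fg)
    from C5[OF this] obtain h where h: "x \<notin> ?L h \<and> - x \<notin> ?L h \<and> (\<forall>y\<in>roots \<alpha> n.
        (y \<in> X \<and> y \<in> Y \<longrightarrow> y \<in> ?L h) \<and>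
        (y \<notin> X \<and> - y \<notin> X \<and> y \<in> Y \<longrightarrow> y \<in> ?L h) \<and>
        (y \<notin> Y \<and> - y \<notin> Y \<and> y \<in> X \<longrightarrow> y \<in> ?L h) \<and>
        (y \<notin> X \<and> - y \<notin> X \<and> y \<notin> Y \<and> - y \<notin> Y \<longrightarrow> y \<notin> ?L h))"
      unfolding fg by (rule exE)
    note Z = bspec[OF conjunct2[OF conjunct2[OF h]]]
    have Z': "\<epsilon> *\<^sub>R y \<in> ?L h \<and> - (\<epsilon> *\<^sub>R y) \<notin> ?L h"
      if y: "y \<in> roots \<alpha> n" and \<epsilon>: "\<epsilon> \<in> {1, - 1 :: real}"
        and "{y, - y} \<inter> X = {} \<and> {y, - y} \<inter> Y = {\<epsilon> *\<^sub>R y} \<or>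
             {y, - y} \<inter> Y = {} \<and> {y, - y} \<inter> X = {\<epsilon> *\<^sub>R y}" for y \<epsilon>
    proof -
      \<comment> \<open>Since \<open>z\<close> is a root with \<open>{z, - z} = {y, - y}\<close>,
        the unsigned claim at \<open>z\<close> handles both values of \<open>\<epsilon>\<close>, and
        clauses (b) and (c) together.\<close>
      define z where "z = \<epsilon> *\<^sub>R y"
      have "{y, - y} = {z, - z}" "z \<in> roots \<alpha> n"
        using \<epsilon> y uminus_roots[OF y] by (auto simp: z_def)
      with that(3) have "z \<in> ?L h" using Z[of z] unfolding z_def[symmetric] by blast
      then show ?thesis using C1 unfolding z_def by blast
    qed
    show ?thesis
    proof (rule bexI[of _ "?L h"], intro conjI ballI impI)
      show "{x, - x} \<inter> ?L h = {}" using h by simp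
      fix y assume y: "y \<in> roots \<alpha> n"
      show "y \<in> ?L h" if "y \<in> X \<inter> Y" using Z[OF y] that by blast
      then show "- y \<notin> ?L h" if "y \<in> X \<inter> Y" using C1 that by blast
      show "{y, - y} \<inter> ?L h = {}" if "{y, - y} \<inter> X = {} \<and> {y, - y} \<inter> Y = {}"
        \<comment> \<open>The unsigned claim excludes one root at a time, so it is used at
          \<open>y\<close> and at \<open>- y\<close>.\<close>
        using Z[OF y] Z[OF uminus_roots[OF y]] that by auto
      show "\<epsilon> *\<^sub>R y \<in> ?L h" and "- (\<epsilon> *\<^sub>R y) \<notin> ?L h"
        if "\<epsilon> \<in> {1, - 1}" "{y, - y} \<inter> X = {} \<and> {y, - y} \<inter> Y = {\<epsilon> *\<^sub>R y}" for \<epsilon> :: real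
        using Z'[OF y that(1)] that(2) by simp_all
      show "\<epsilon> *\<^sub>R y \<in> ?L h" and "- (\<epsilon> *\<^sub>R y) \<notin> ?L h"
        if "\<epsilon> \<in> {1, - 1}" "{y, - y} \<inter> Y = {} \<and> {y, - y} \<inter> X = {\<epsilon> *\<^sub>R y}" for \<epsilon> :: real
        using Z'[OF y that(1)] that(2) by simp_all
    qed (rule rangeI)
  qed
  show ?thesis
    unfolding horocyclic_subsets_eq_level_roots[OF \<alpha>]
  proof (intro conjI)
    show "\<forall>X\<in>range ?L. X \<inter> uminus ` X = {}" using C1 by auto
    show "{} \<in> range ?L" using C2 by (metis rangeI)
    show "\<forall>X\<in>range ?L. uminus ` X \<in> range ?L" using C3 by blast
    show "\<forall>X\<in>range ?L. \<forall>Y\<in>range ?L. sign_comp X Y \<in> range ?L" using C4 by blast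
  qed (intro ballI allI impI, rule elim)
qed

end
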